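(* Let $X$ be a nontrivial real Banach space and let $F:X\times X\to\mathbb{R}$ satisfy $F(x,x)=0$ for all $x\in X$. Assume that $F(x,\cdot)$ is convex and continuous for all $x\in X$ and that $F(\cdot,y)$ is concave and continuous for all $y\in X$. Then $A^F$ is a maximal monotone operator and $A^F={}^F\!A$.
   Context: $X^*$ is the topological dual of $X$ and $\langle x^*,x\rangle$ the value of $x^*\in X^*$ at $x\in X$. For a function $F:X\times X\to\mathbb{R}$, the operators $A^F,{}^F\!A:X\rightrightarrows X^*$ are defined, for $x\in X$, by $$A^F(x)=\{x^*\in X^*:F(x,y)-F(x,x)\ge\langle x^*,y-x\rangle\ \forall y\in X\},\qquad {}^F\!A(x)=\{x^*\in X^*:F(x,x)-F(y,x)\ge\langle x^*,y-x\rangle\ \forall y\in X\}.$$ A multifunction $T:X\rightrightarrows X^*$ is monotone if $\langle y^*-x^*,y-x\rangle\ge 0$ whenever $x^*\in T(x)$, $y^*\in T(y)$; it is maximal monotone if moreover its graph is not properly included in the graph of another monotone operator. *)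

theory Defs
  imports "HOL-Analysis.Analysis"
begin

type_synonym 'a operator = "'a \<Rightarrow> ('a \<Rightarrow>\<^sub>L real) set"

(* A^F: the operator built from the second argument of F. *)
definition right_operator :: "('a::real_normed_vector \<Rightarrow> 'a \<Rightarrow> real) \<Rightarrow> 'a operator"
  where "right_operator F x =
    {x'. \<forall>y. F x y - F x x \<ge> blinfun_apply x' (y - x)}"

(* ^F A: the operator built from the first argument of F. *)
definition left_operator :: "('a::real_normed_vector \<Rightarrow> 'a \<Rightarrow> real) \<Rightarrow> 'a operator"
  where "left_operator F x =
    {x'. \<forall>y. F x x - F y x \<ge> blinfun_apply x' (y - x)}"

definition operator_graph :: "'a::real_normed_vector operator \<Rightarrow> ('a \<times> ('a \<Rightarrow>\<^sub>L real)) set"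
  where "operator_graph T = {(x, x'). x' \<in> T x}"

definition monotone_operator :: "'a::real_normed_vector operator \<Rightarrow> bool"
  where "monotone_operator T \<longleftrightarrow>
    (\<forall>x y. \<forall>x'\<in>T x. \<forall>y'\<in>T y. blinfun_apply (y' - x') (y - x) \<ge> 0)"

definition maximal_monotone_operator :: "'a::real_normed_vector operator \<Rightarrow> bool"
  where "maximal_monotone_operator T \<longleftrightarrow>
    monotone_operator T \<and>
    \<not> (\<exists>S. monotone_operator S \<and> operator_graph T \<subset> operator_graph S)"

end

theory Submission
  imports Defs
begin

text \<open>
  If \<open>x'\<close> is a subgradient of \<open>F x\<close> at \<open>x\<close>, then for \<open>z = x + t (y - x)\<close> concavity gives
  \<open>0 = F z z \<ge> (1 - t) F x z + t F y z \<ge> t ((1 - t) x' (y - x) + F y z)\<close>; dividing by \<open>t\<close> and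
  letting \<open>t\<close> tend to 0 yields \<open>F y x \<le> x' (x - y)\<close>. Applying this to \<open>\<lambda>x y. - F y x\<close> gives
  the converse, so the two operators agree, and adding the two inequalities gives monotonicity.
  For maximality, let \<open>(z, z')\<close> be monotonically related to the graph. Every \<open>F x\<close> has a
  subgradient at \<open>x\<close> by Hahn-Banach, so take \<open>x'\<close> in the operator at \<open>x = z + t d\<close>; then
  \<open>F x (z + d) \<ge> (1 - t) x' d \<ge> (1 - t) z' d\<close>, and \<open>t\<close> tending to 0 gives
  \<open>F z (z + d) \<ge> z' d\<close>.
\<close>

section \<open>Linear minorants of convex functions\<close>

text \<open>\<open>conv\<close> is a joint convexity in index and point: nearly optimal indices for
  \<open>x\<close> and \<open>y\<close> yield one for the combination. It covers a parameter
  interval, where indices are averaged, and a chain of functions, where the smaller one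
  serves.\<close>

lemma convex_on_INF:
  fixes f :: "'i \<Rightarrow> 'a::real_vector \<Rightarrow> real"
  assumes ne: "I \<noteq> {}"
    and bdd: "\<And>x. bdd_below ((\<lambda>i. f i x) ` I)"
    and conv: "\<And>i j x y t. \<lbrakk>i \<in> I; j \<in> I; 0 < t; t < 1\<rbrakk> \<Longrightarrow>
      \<exists>k\<in>I. f k ((1 - t) *\<^sub>R x + t *\<^sub>R y) \<le> (1 - t) * f i x + t * f j y"
  shows "convex_on UNIV (\<lambda>x. INF i\<in>I. f i x)"
proof (rule convex_onI)
  fix t :: real and x y :: 'a
  assume t: "0 < t" "t < 1"
  let ?u = "\<lambda>x. INF i\<in>I. f i x"
  show "?u ((1 - t) *\<^sub>R x + t *\<^sub>R y) \<le> (1 - t) * ?u x + t * ?u y"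
  proof (rule field_le_epsilon)
    fix e :: real assume e: "0 < e"
    obtain i where i: "i \<in> I" "f i x < ?u x + e"
      using e cINF_less_iff[OF ne bdd, of x "?u x + e"] by auto
    obtain j where j: "j \<in> I" "f j y < ?u y + e"
      using e cINF_less_iff[OF ne bdd, of y "?u y + e"] by auto
    obtain k where k: "k \<in> I"
      "f k ((1 - t) *\<^sub>R x + t *\<^sub>R y) \<le> (1 - t) * f i x + t * f j y"
      using conv[OF i(1) j(1) t] by blast
    have "?u ((1 - t) *\<^sub>R x + t *\<^sub>R y) \<le> f k ((1 - t) *\<^sub>R x + t *\<^sub>R y)"
      by (rule cINF_lower[OF bdd k(1)])
    also note k(2)
    also have "(1 - t) * f i x + t * f j y \<le> (1 - t) * (?u x + e) + t * (?u y + e)"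
      using i j t by (intro add_mono mult_left_mono) auto
    also have "\<dots> = (1 - t) * ?u x + t * ?u y + e"
      by (simp add: algebra_simps)
    finally show "?u ((1 - t) *\<^sub>R x + t *\<^sub>R y) \<le> (1 - t) * ?u x + t * ?u y + e" .
  qed
qed simp

text \<open>
  Convex functions vanishing at the origin are bounded below by their own reflection, so Zorn's
  lemma yields one that is pointwise minimal below the given one; minimality forces linearity.
\<close>

lemma convex_reflection_bound:
  fixes h :: "'a::real_vector \<Rightarrow> real"
  assumes "convex_on UNIV h" "h 0 = 0"
  shows "- h (- x) \<le> h x"
  using convex_onD[OF assms(1), of "1/2" x "- x"] assms(2) by simp

text \<open>Minimality is tested against two competitors below \<open>h\<close>: rescalings give
  positive homogeneity, hence subadditivity, and an infimum of shifts along \<open>y\<close> gives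
  oddness. An odd sublinear function is linear.\<close>

lemma minimal_convex_linear:
  fixes h :: "'a::real_vector \<Rightarrow> real"
  assumes conv: "convex_on UNIV h" and zero: "h 0 = 0"
    and min: "\<And>k. \<lbrakk>convex_on UNIV k; k 0 = 0; k \<le> h\<rbrakk> \<Longrightarrow> k = h"
  shows "linear h"
proof -
  have scale_lt1: "h (s *\<^sub>R x) = s * h x" if s: "0 < s" "s < 1" for s x
  proof -
    \<comment> \<open>Convexity and \<open>h 0 = 0\<close> give
      \<open>h (s *\<^sub>R x) \<le> s * h x\<close>, so \<open>?k\<close> lies below
      \<open>h\<close>.\<close>
    let ?k = "\<lambda>x. h (s *\<^sub>R x) / s"
    have "convex_on UNIV ?k"
    proof (rule convex_onI)
      fix t :: real and x y :: 'a
      assume t: "0 < t" "t < 1"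
      have "h ((1 - t) *\<^sub>R (s *\<^sub>R x) + t *\<^sub>R (s *\<^sub>R y))
          \<le> (1 - t) * h (s *\<^sub>R x) + t * h (s *\<^sub>R y)"
        using t by (intro convex_onD[OF conv]) simp_all
      also have "(1 - t) *\<^sub>R (s *\<^sub>R x) + t *\<^sub>R (s *\<^sub>R y) = s *\<^sub>R ((1 - t) *\<^sub>R x + t *\<^sub>R y)"
        by (simp add: algebra_simps)
      finally have "h (s *\<^sub>R ((1 - t) *\<^sub>R x + t *\<^sub>R y)) / s
          \<le> ((1 - t) * h (s *\<^sub>R x) + t * h (s *\<^sub>R y)) / s"
        using s by (intro divide_right_mono) linarith+
      then show "?k ((1 - t) *\<^sub>R x + t *\<^sub>R y) \<le> (1 - t) * ?k x + t * ?k y"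
        by (simp only: add_divide_distrib times_divide_eq_right)
    qed simp
    moreover have "?k 0 = 0"
      using zero by simp
    moreover have "?k \<le> h"
      using convex_onD[OF conv, of s 0] s zero by (simp add: le_fun_def field_simps)
    ultimately have "?k = h"
      by (rule min)
    from fun_cong[OF this, of x] s show ?thesis
      by (simp add: field_simps)
  qed
  have scale: "h (s *\<^sub>R x) = s * h x" if s: "0 < s" for s x
  proof -
    consider "s < 1" | "s = 1" | "s > 1" by linarith
    then show ?thesis
    proof cases
      case 3
      then show ?thesis
        using scale_lt1[of "inverse s" "s *\<^sub>R x"] by (simp add: field_simps)
    qed (use s scale_lt1 in auto)
  qed
  have subadd: "h (x + y) \<le> h x + h y" for x y
    using convex_onD[OF conv, of "1/2" "2 *\<^sub>R x" "2 *\<^sub>R y"] scale[of 2] by simp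
  have odd: "h (- y) = - h y" for y
  proof -
    \<comment> \<open>The member \<open>t = 0\<close> places \<open>?k\<close> below
      \<open>h\<close>, so the two coincide; the member \<open>t = 1\<close>, evaluated at
      \<open>- y\<close>, then gives \<open>h (- y) \<le> - h y\<close>.\<close>
    let ?f = "\<lambda>t x. h (x + t *\<^sub>R y) - t * h y"
    let ?k = "\<lambda>x. INF t\<in>{0..}. ?f t x"
    have scale0: "h (t *\<^sub>R y) = t * h y" if "t \<ge> 0" for t
      using that scale[of t y] zero by (cases "t = 0") auto
    \<comment> \<open>The bound is independent of \<open>t\<close>, so the infimum is a genuine
      one.\<close>
    have lower: "- h (- x) \<le> ?f t x" if "t \<ge> 0" for t x
      using subadd[of "x + t *\<^sub>R y" "- x"] scale0[OF that] by simp
    have bdd: "bdd_below ((\<lambda>t. ?f t x) ` {0..})" for x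
      using lower by (intro bdd_belowI2) auto
    have "convex_on UNIV ?k"
    proof (rule convex_on_INF[OF _ bdd])
      fix i j t :: real and x z :: 'a
      assume ij: "i \<in> {0..}" "j \<in> {0..}" and t: "0 < t" "t < 1"
      let ?l = "(1 - t) * i + t * j"
      have "h ((1 - t) *\<^sub>R (x + i *\<^sub>R y) + t *\<^sub>R (z + j *\<^sub>R y))
          \<le> (1 - t) * h (x + i *\<^sub>R y) + t * h (z + j *\<^sub>R y)"
        using convex_onD[OF conv, of t] t by simp
      moreover have "(1 - t) *\<^sub>R x + t *\<^sub>R z + ?l *\<^sub>R y
          = (1 - t) *\<^sub>R (x + i *\<^sub>R y) + t *\<^sub>R (z + j *\<^sub>R y)"
        by (simp add: algebra_simps)
      ultimately have "?f ?l ((1 - t) *\<^sub>R x + t *\<^sub>R z) \<le> (1 - t) * ?f i x + t * ?f j z"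
        by (simp add: algebra_simps)
      moreover have "?l \<in> {0..}"
        using ij t by simp
      ultimately show "\<exists>l\<in>{0..}. ?f l ((1 - t) *\<^sub>R x + t *\<^sub>R z) \<le> (1 - t) * ?f i x + t * ?f j z"
        by blast
    qed simp
    moreover have "?k 0 = 0"
      using scale0 by simp
    moreover have "?k \<le> h"
    proof (rule le_funI)
      fix x show "?k x \<le> h x"
        using cINF_lower[OF bdd, of 0 x] by simp
    qed
    ultimately have "?k = h"
      by (rule min)
    from fun_cong[OF this[symmetric], of "- y"] have "h (- y) = ?k (- y)" .
    also have "\<dots> \<le> - h y"
      using cINF_lower[OF bdd, of 1 "- y"] zero by simp
    finally have "h (- y) \<le> - h y" .
    then show ?thesis
      using convex_reflection_bound[OF conv zero, of y] by simp
  qed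
  show ?thesis
  proof (rule linearI)
    fix x y
    show "h (x + y) = h x + h y"
      \<comment> \<open>Oddness turns subadditivity at \<open>- x\<close> and \<open>- y\<close>
        into the reverse inequality.\<close>
      using subadd[of x y] subadd[of "- x" "- y"] odd[of x] odd[of y] odd[of "x + y"] by simp
  next
    fix r :: real and x
    consider "r > 0" | "r = 0" | "r < 0" by linarith
    then show "h (r *\<^sub>R x) = r *\<^sub>R h x"
    proof cases
      case 3
      then show ?thesis
        using scale[of "- r" "- x"] odd[of x] by simp
    qed (use scale zero in auto)
  qed
qed

text \<open>The algebraic core of Hahn-Banach, with a convex majorant in place of a sublinear
  one.\<close>

lemma convex_linear_minorant:
  fixes g :: "'a::real_vector \<Rightarrow> real"
  assumes conv: "convex_on UNIV g" and zero: "g 0 = 0"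
  obtains f where "linear f" "f \<le> g"
proof -
  define A where "A = {h. convex_on UNIV h \<and> h 0 = 0 \<and> h \<le> g}"
  have gA: "g \<in> A"
    using conv zero by (simp add: A_def)
  \<comment> \<open>The order is reversed, so the bounds of chains that Zorn's lemma asks for are
    pointwise infima.\<close>
  have "\<exists>m\<in>A. \<forall>a\<in>A. m \<ge> a \<longrightarrow> a = m"
  proof (rule predicate_Zorn)
    show "partial_order_on A (relation_of (\<ge>) A)"
      by (auto simp: partial_order_on_def preorder_on_def refl_on_def trans_def antisym_def
          relation_of_def)
  next
    fix C assume C: "C \<in> Chains (relation_of (\<ge>) A)"
    show "\<exists>u\<in>A. \<forall>a\<in>C. a \<ge> u"
    proof (cases "C = {}")
      case True
      then show ?thesis using gA by auto
    next
      case ne: False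
      have CA: "C \<subseteq> A" and chain: "\<And>h k. \<lbrakk>h \<in> C; k \<in> C\<rbrakk> \<Longrightarrow> h \<le> k \<or> k \<le> h"
        using C by (auto simp: Chains_def relation_of_def)
      let ?u = "\<lambda>x. INF h\<in>C. h x"
      \<comment> \<open>Reflection bounds \<open>h x\<close> from below through
        \<open>h (- x)\<close>, and \<open>h \<le> g\<close> makes this uniform over the
        chain.\<close>
      have lower: "- g (- x) \<le> h x" if "h \<in> C" for h x
      proof -
        have "- h (- x) \<le> h x" "h (- x) \<le> g (- x)"
          using that CA convex_reflection_bound[of h x] by (auto simp: A_def le_fun_def)
        then show ?thesis by linarith
      qed
      have bdd: "bdd_below ((\<lambda>h. h x) ` C)" for x
        using lower by (intro bdd_belowI2)
      have "convex_on UNIV ?u"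
      proof (rule convex_on_INF[OF ne bdd])
        fix h k and x y :: 'a and t :: real
        assume hk: "h \<in> C" "k \<in> C" and t: "0 < t" "t < 1"
        obtain l where l: "l \<in> C" "l \<le> h" "l \<le> k"
          using chain[OF hk] hk by blast
        have "l ((1 - t) *\<^sub>R x + t *\<^sub>R y) \<le> (1 - t) * l x + t * l y"
          using l CA t convex_onD[of UNIV l t] by (auto simp: A_def)
        also have "\<dots> \<le> (1 - t) * h x + t * k y"
          using l t by (intro add_mono mult_left_mono) (auto simp: le_fun_def)
        finally show "\<exists>l\<in>C. l ((1 - t) *\<^sub>R x + t *\<^sub>R y) \<le> (1 - t) * h x + t * k y"
          using l by blast
      qed
      moreover have "?u 0 = 0"
      proof -
        have "(\<lambda>h. h 0) ` C = (\<lambda>_. 0) ` C"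
          using CA by (intro image_cong) (auto simp: A_def)
        then show ?thesis using ne by simp
      qed
      moreover have below: "?u \<le> h" if "h \<in> C" for h
        using cINF_lower[OF bdd that] by (simp add: le_fun_def)
      moreover have "?u \<le> g"
      proof -
        obtain h where "h \<in> C" using ne by blast
        then show ?thesis
          using below[of h] CA by (auto simp: A_def intro: order_trans)
      qed
      ultimately have "?u \<in> A"
        by (simp add: A_def)
      then show ?thesis
        using below by blast
    qed
  qed
  then obtain m where m: "convex_on UNIV m" "m 0 = 0" "m \<le> g"
    and min: "\<And>k. \<lbrakk>k \<in> A; k \<le> m\<rbrakk> \<Longrightarrow> k = m"
    by (auto simp: A_def)
  have "linear m"
  proof (rule minimal_convex_linear[OF m(1,2)])
    fix k :: "'a \<Rightarrow> real" assume "convex_on UNIV k" "k 0 = 0" "k \<le> m"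
    then show "k = m"
      using m(3) by (intro min) (auto simp: A_def)
  qed
  with m(3) show thesis
    using that by blast
qed

section \<open>Bounded subgradients\<close>

text \<open>A linear minorant of the increment at \<open>x\<close> lacks only boundedness.
  Continuity supplies it: the minorant is at most 1 on a ball around 0, and linearity turns this
  into a norm bound.\<close>

lemma convex_subgradient:
  fixes g :: "'a::real_normed_vector \<Rightarrow> real"
  assumes conv: "convex_on UNIV g" and cont: "isCont g x"
  obtains x' :: "'a \<Rightarrow>\<^sub>L real" where "\<And>y. x' (y - x) \<le> g y - g x"
proof -
  have "convex_on UNIV (\<lambda>d. g (x + d) - g x)"
  proof (rule convex_onI)
    fix t :: real and d e :: 'a
    assume t: "0 < t" "t < 1"
    have "g ((1 - t) *\<^sub>R (x + d) + t *\<^sub>R (x + e)) \<le> (1 - t) * g (x + d) + t * g (x + e)"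
      using convex_onD[OF conv, of t] t by simp
    moreover have "x + ((1 - t) *\<^sub>R d + t *\<^sub>R e) = (1 - t) *\<^sub>R (x + d) + t *\<^sub>R (x + e)"
      by (simp add: algebra_simps)
    ultimately show "g (x + ((1 - t) *\<^sub>R d + t *\<^sub>R e)) - g x
        \<le> (1 - t) * (g (x + d) - g x) + t * (g (x + e) - g x)"
      by (simp add: algebra_simps)
  qed simp
  then obtain f where lin: "linear f" and le: "f \<le> (\<lambda>d. g (x + d) - g x)"
    by (rule convex_linear_minorant) simp
  have fle: "f d \<le> g (x + d) - g x" for d
    using le by (simp add: le_fun_def)
  obtain r where r: "r > 0" "\<And>y. dist y x < r \<Longrightarrow> dist (g y) (g x) < 1"
    using cont unfolding continuous_at_eps_delta by (metis zero_less_one dist_commute)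
  have f_bound: "f d \<le> norm d * (2 / r)" for d
  proof (cases "d = 0")
    case True
    then show ?thesis using linear_0[OF lin] by simp
  next
    case False
    \<comment> \<open>\<open>s *\<^sub>R d\<close> has norm \<open>r / 2\<close>, inside the ball
      where the increment of \<open>g\<close> stays below 1.\<close>
    define s where "s = r / (2 * norm d)"
    have s: "s > 0" "norm (s *\<^sub>R d) < r"
      using False r by (auto simp: s_def)
    have "s * f d = f (s *\<^sub>R d)"
      by (simp add: linear_scale[OF lin])
    also have "\<dots> \<le> 1"
      using fle[of "s *\<^sub>R d"] r(2)[of "x + s *\<^sub>R d"] s(2) by (auto simp: dist_norm)
    finally have "f d \<le> 1 / s"
      using s(1) by (simp add: field_simps)
    then show ?thesis
      by (simp add: s_def field_simps)
  qed
  have "bounded_linear f"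
  proof (rule bounded_linear_intro)
    show "norm (f d) \<le> norm d * (2 / r)" for d
      using f_bound[of d] f_bound[of "- d"] linear_neg[OF lin, of d] by (auto simp: abs_le_iff)
  qed (simp_all add: linear_add[OF lin] linear_scale[OF lin])
  then have "blinfun_apply (Blinfun f) (y - x) \<le> g y - g x" for y
    using fle[of "y - x"] by (simp add: bounded_linear_Blinfun_apply)
  then show thesis
    by (rule that)
qed

section \<open>Comparison of the two operators\<close>

text \<open>With concavity asked in the first variable and continuity in the second,
  \<open>\<lambda>x y. - F y x\<close> also qualifies once \<open>F\<close> is convex in the second
  and continuous in the first.\<close>

lemma right_operator_subset_left_operator:
  assumes diagonal: "\<And>x. F x x = 0"
    and continuous_right: "\<And>x. continuous_on UNIV (\<lambda>y. F x y)"
    and concave: "\<And>y. concave_on UNIV (\<lambda>x. F x y)"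
  shows "right_operator F x \<subseteq> left_operator F x"
proof
  fix x' assume x': "x' \<in> right_operator F x"
  then have sub: "x' (y - x) \<le> F x y" for y
    by (simp add: right_operator_def diagonal)
  have "x' (y - x) \<le> - F y x" for y
  proof -
    let ?z = "\<lambda>t. x + t *\<^sub>R (y - x)"
    have ineq: "F y (?z t) \<le> - (1 - t) * x' (y - x)" if t: "0 < t" "t < 1" for t
    proof -
      have "(1 - t) *\<^sub>R x + t *\<^sub>R y = ?z t"
        by (simp add: algebra_simps)
      then have "(1 - t) * F x (?z t) + t * F y (?z t) \<le> 0"
        using concave_onD[OF concave[of "?z t"], of t x y] t diagonal[of "?z t"] by simp
      moreover have "t * x' (y - x) \<le> F x (?z t)"
        using sub[of "?z t"] by (simp add: blinfun.scaleR_right)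
      \<comment> \<open>Scaling by \<open>1 - t\<close> matches the concavity weight and leaves a
        common factor \<open>t\<close> to cancel.\<close>
      then have "(1 - t) * (t * x' (y - x)) \<le> (1 - t) * F x (?z t)"
        using t by (intro mult_left_mono) auto
      ultimately have "t * F y (?z t) \<le> t * (- (1 - t) * x' (y - x))"
        by (simp add: algebra_simps)
      then show ?thesis
        using t by simp
    qed
    have "((\<lambda>t. ?z t) \<longlongrightarrow> ?z 0) (at_right 0)"
      by (intro tendsto_intros)
    then have "((\<lambda>t. F y (?z t)) \<longlongrightarrow> F y (?z 0)) (at_right 0)"
      using continuous_right[of y]
      by (intro isCont_tendsto_compose[of _ "F y"]) (simp_all add: continuous_on_eq_continuous_at)
    moreover have "((\<lambda>t. - (1 - t) * x' (y - x)) \<longlongrightarrow> - (1 - 0) * x' (y - x)) (at_right 0)"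
      by (intro tendsto_intros)
    moreover have "\<forall>\<^sub>F t in at_right 0. F y (?z t) \<le> - (1 - t) * x' (y - x)"
      using ineq by (intro eventually_at_rightI[of 0 1]) auto
    ultimately have "F y (?z 0) \<le> - (1 - 0) * x' (y - x)"
      using tendsto_le[OF trivial_limit_at_right_real] by blast
    then show ?thesis
      by simp
  qed
  then show "x' \<in> left_operator F x"
    by (simp add: left_operator_def diagonal)
qed


section \<open>Maximal monotonicity\<close>

theorem theorem8:
  fixes F :: "'a::banach \<Rightarrow> 'a \<Rightarrow> real"
  assumes nontrivial: "\<exists>x::'a. x \<noteq> 0"
    and diagonal: "\<And>x. F x x = 0"
    and convex: "\<And>x. convex_on UNIV (\<lambda>y. F x y)"
    and continuous_right: "\<And>x. continuous_on UNIV (\<lambda>y. F x y)"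
    and concave: "\<And>y. concave_on UNIV (\<lambda>x. F x y)"
    and continuous_left: "\<And>y. continuous_on UNIV (\<lambda>x. F x y)"
  shows "maximal_monotone_operator (right_operator F) \<and> right_operator F = left_operator F"
proof -
  let ?A = "right_operator F"
  have eq: "?A = left_operator F"
  proof (rule ext, rule equalityI)
    fix x
    show "?A x \<subseteq> left_operator F x"
      by (rule right_operator_subset_left_operator[OF diagonal continuous_right concave])
    \<comment> \<open>Exchanging the arguments and the sign swaps the two operators, so this is the
      reverse inclusion.\<close>
    have "right_operator (\<lambda>x y. - F y x) x \<subseteq> left_operator (\<lambda>x y. - F y x) x"
      using diagonal continuous_left concave convex
      by (intro right_operator_subset_left_operator)
        (auto simp: concave_on_def intro: continuous_on_minus)
    then show "left_operator F x \<subseteq> ?A x"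
      by (simp add: right_operator_def left_operator_def)
  qed
  have mono: "monotone_operator ?A"
    unfolding monotone_operator_def
  proof (intro allI ballI)
    fix x y x' y' assume x': "x' \<in> ?A x" and y': "y' \<in> ?A y"
    have "x' (y - x) \<le> F x y"
      using x' by (simp add: right_operator_def diagonal)
    \<comment> \<open>Reading \<open>y'\<close> in the left operator brings in the same value:
      \<open>x' (y - x) \<le> F x y \<le> y' (y - x)\<close>.\<close>
    moreover have "y' (x - y) \<le> - F x y"
      using y' unfolding eq by (simp add: left_operator_def diagonal)
    ultimately show "(y' - x') (y - x) \<ge> 0"
      by (simp add: blinfun.diff_left blinfun.diff_right)
  qed
  have maximal: "z' \<in> ?A z" if S: "monotone_operator S" "operator_graph ?A \<subseteq> operator_graph S"
    and z': "z' \<in> S z" for S z z'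
  proof -
    have "z' (y - z) \<le> F z y" for y
    proof -
      let ?x = "\<lambda>t. z + t *\<^sub>R (y - z)"
      have ineq: "(1 - t) * z' (y - z) \<le> F (?x t) y" if t: "0 < t" "t < 1" for t
      proof -
        have "isCont (F (?x t)) (?x t)"
          using continuous_right by (simp add: continuous_on_eq_continuous_at)
        then obtain x' :: "'a \<Rightarrow>\<^sub>L real" where "\<And>w. x' (w - ?x t) \<le> F (?x t) w - F (?x t) (?x t)"
          using convex_subgradient[OF convex] by blast
        then have x': "x' \<in> ?A (?x t)"
          by (simp add: right_operator_def)
        then have "x' \<in> S (?x t)"
          using S(2) by (auto simp: operator_graph_def)
        then have "0 \<le> (x' - z') (?x t - z)"
          using S(1) z' unfolding monotone_operator_def by blast
        \<comment> \<open>\<open>?x t - z\<close> is \<open>t *\<^sub>R (y - z)\<close>, and the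
          positive factor \<open>t\<close> cancels.\<close>
        then have "z' (y - z) \<le> x' (y - z)"
          using t by (simp add: blinfun.diff_left blinfun.scaleR_right
              zero_le_mult_iff flip: right_diff_distrib)
        then have "(1 - t) * z' (y - z) \<le> (1 - t) * x' (y - z)"
          using t by (intro mult_left_mono) auto
        also have "\<dots> = x' ((1 - t) *\<^sub>R (y - z))"
          by (simp add: blinfun.scaleR_right)
        also have "(1 - t) *\<^sub>R (y - z) = y - ?x t"
          by (simp add: algebra_simps)
        also have "x' (y - ?x t) \<le> F (?x t) y"
          using x' by (simp add: right_operator_def diagonal)
        finally show ?thesis .
      qed
      \<comment> \<open>The base point moves while \<open>y\<close> stays fixed, so the limit uses
        continuity in the first variable.\<close>
      have "((\<lambda>t. ?x t) \<longlongrightarrow> ?x 0) (at_right 0)"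
        by (intro tendsto_intros)
      then have "((\<lambda>t. F (?x t) y) \<longlongrightarrow> F (?x 0) y) (at_right 0)"
        using continuous_left[of y]
        by (intro isCont_tendsto_compose[of _ "\<lambda>x. F x y"])
          (simp_all add: continuous_on_eq_continuous_at)
      moreover have "((\<lambda>t. (1 - t) * z' (y - z)) \<longlongrightarrow> (1 - 0) * z' (y - z)) (at_right 0)"
        by (intro tendsto_intros)
      moreover have "\<forall>\<^sub>F t in at_right 0. (1 - t) * z' (y - z) \<le> F (?x t) y"
        using ineq by (intro eventually_at_rightI[of 0 1]) auto
      ultimately show ?thesis
        using tendsto_le[OF trivial_limit_at_right_real] by fastforce
    qed
    then show ?thesis
      by (simp add: right_operator_def diagonal)
  qed
  have "\<not> (\<exists>S. monotone_operator S \<and> operator_graph ?A \<subset> operator_graph S)"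
  proof
    assume "\<exists>S. monotone_operator S \<and> operator_graph ?A \<subset> operator_graph S"
    then obtain S where S: "monotone_operator S" "operator_graph ?A \<subset> operator_graph S"
      by blast
    have "operator_graph S \<subseteq> operator_graph ?A"
      using maximal[OF S(1)] S(2) by (auto simp: operator_graph_def)
    with S(2) show False
      by blast
  qed
  with mono eq show ?thesis
    by (simp add: maximal_monotone_operator_def)
qed

end
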